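(* Let $z$ be a vexillary involution in $S_\infty$, and let $p=q=0$ if $z=1$, otherwise $p=|\{i>0:i<z(i)\}|$ and $q=\max\{i>0:z(i)\ne i\}$. Then the vexillary weak order graph contains a directed path $z\xrightarrow{i_1}\cdots\xrightarrow{i_k}\mathsf{dom}_{pq}$ with $\{i_1,\dots,i_k\}\subseteq[q-1]$. Moreover, if $i<z(i)$ for all $i\in[p]$, then any such path has $p\notin\{i_1,\dots,i_k\}$.
   Context: $S_\infty$: permutations of $\mathbb{Z}$ fixing all $i\le0$ and all but finitely many $i$; $s_i=(i,i+1)$; $\ell$ = number of inversions; vexillary = $2143$-avoiding. The vexillary weak order graph has vertex set the vexillary involutions in $S_\infty$ and a labeled edge $v\xrightarrow{i}w$ whenever $w=s_ivs_i$ and $\ell(v)<\ell(w)$. For $q\ge2p$, $\mathsf{dom}_{pq}=(1,q)(2,q-1)\cdots(p,q-p+1)$ and $\mathsf{dom}_{00}=1$. *)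

theory Defs
  imports "HOL-Combinatorics.Transposition" "Graph_Theory.Arc_Walk"
begin

definition S_inf :: "(int \<Rightarrow> int) set" where
  "S_inf = {z. bij z \<and> (\<forall>i\<le>0. z i = i) \<and> finite {i. z i \<noteq> i}}"

abbreviation s :: "int \<Rightarrow> int \<Rightarrow> int" where
  "s i \<equiv> transpose i (i + 1)"

text \<open>The set of inversions is finite for elements of \<^term>\<open>S_inf\<close>, so \<open>card\<close> is meaningful there.\<close>

definition perm_length :: "(int \<Rightarrow> int) \<Rightarrow> nat" where
  "perm_length z = card {(i, j). i < j \<and> z j < z i}"

definition vexillary :: "(int \<Rightarrow> int) \<Rightarrow> bool" where
  "vexillary z \<longleftrightarrow>
    \<not> (\<exists>a b c d. a < b \<and> b < c \<and> c < d \<and> z b < z a \<and> z a < z d \<and> z d < z c)"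

text \<open>The identity counts as an involution.\<close>

definition vex_involutions :: "(int \<Rightarrow> int) set" where
  "vex_involutions = {z \<in> S_inf. z \<circ> z = id \<and> vexillary z}"

text \<open>An arc is a triple \<open>(v, i, w)\<close>, so that parallel edges with distinct labels are kept apart.
  The condition \<open>0 < i\<close> says that \<open>s i\<close> lies in \<^term>\<open>S_inf\<close>.\<close>

definition vex_graph :: "(int \<Rightarrow> int, (int \<Rightarrow> int) \<times> int \<times> (int \<Rightarrow> int)) pre_digraph" where
  "vex_graph = \<lparr>
    verts = vex_involutions,
    arcs = {(v, i, w). v \<in> vex_involutions \<and> w \<in> vex_involutions \<and> 0 < i \<and>
      w = s i \<circ> v \<circ> s i \<and> perm_length v < perm_length w},
    tail = (\<lambda>(v, i, w). v),
    head = (\<lambda>(v, i, w). w)\<rparr>"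

definition edge_labels :: "((int \<Rightarrow> int) \<times> int \<times> (int \<Rightarrow> int)) list \<Rightarrow> int set" where
  "edge_labels es = (\<lambda>(v, i, w). i) ` set es"

text \<open>Only used for \<open>0 \<le> 2 * p \<le> q\<close>, where the transpositions are nontrivial and disjoint.
  For \<open>p = 0\<close> the product is empty, which covers the convention for \<open>p = q = 0\<close>.\<close>

definition dom_perm :: "int \<Rightarrow> int \<Rightarrow> (int \<Rightarrow> int)" where
  "dom_perm p q = foldr (\<circ>) (map (\<lambda>j. transpose j (q - j + 1)) [1..p]) id"

end

theory Submission
  imports Defs
begin

text \<open>Call \<open>i\<close> a nontrivial ascent of \<open>v\<close> if \<open>v i < v (i + 1)\<close> and \<open>i\<close>, \<open>i + 1\<close> are not both fixed;
  conjugation by \<open>s i\<close> then increases the length. It keeps \<open>v\<close> vexillary unless \<open>i\<close>, \<open>i + 1\<close> are the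
  last two positions of a 2134-pattern or the first two of a 1243-pattern. An ascent avoiding both
  exists whenever there is a nontrivial one: if \<open>v\<close> has 132-patterns on the positive integers, take
  one at \<open>e < c < d\<close> with \<open>v d\<close> maximal and an \<open>i\<close> between \<open>e\<close> and \<open>c\<close> where the values cross \<open>v d\<close>;
  otherwise take the first nontrivial ascent. Without nontrivial ascents below \<open>q\<close>, the non-fixed
  points are order-reversed against everything else in \<open>{1..q}\<close>, which forces \<open>dom_perm\<close>.\<close>

section \<open>Openers and elementary order facts\<close>

text \<open>For an involution in \<open>S_inf\<close> these are the smaller elements of the
  2-cycles. Their number is the \<open>p\<close> of the theorem and stays constant along
  edges.\<close>

definition openers :: "(int \<Rightarrow> int) \<Rightarrow> int set" where
  "openers z = {i. 0 < i \<and> i < z i}"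

lemma s_less:
  assumes "a < b" and "\<not> (a = i \<and> b = i + 1)"
  shows "s i a < s i b"
  using assms by (auto simp: transpose_def)

text \<open>A discrete intermediate value principle: it finds the position where the values of a
  permutation cross a given level.\<close>

lemma ex_step_int:
  fixes j k :: int
  assumes "j < k" "P j" "\<not> P k"
  shows "\<exists>i\<ge>j. i < k \<and> P i \<and> \<not> P (i + 1)"
proof (rule ccontr)
  assume none: "\<not> ?thesis"
  have "m \<le> k \<longrightarrow> P m" if "j \<le> m" for m
    using that
  proof (induction m rule: int_ge_induct)
    case base
    then show ?case using assms(2) by simp
  next
    case (step m)
    then show ?case using none by auto
  qed
  then show False using assms by auto
qed

section \<open>Support, inversions and length in \<open>S_inf\<close>\<close>

text \<open>A value \<open>v j\<close> outside the interval would be a fixed point, and injectivity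
  would give \<open>v j = j\<close>.\<close>

lemma S_inf_interval:
  assumes "v \<in> S_inf" "\<forall>j>q. v j = j" "j \<in> {1..q}"
  shows "v j \<in> {1..q}"
proof -
  have inj: "inj v" and fix0: "\<forall>i\<le>0. v i = i"
    using assms(1) by (auto simp: S_inf_def bij_def)
  have "v (v j) \<noteq> v j" if "v j \<noteq> j"
    using inj that by (metis injD)
  then show ?thesis
    using assms(2,3) fix0 by (metis atLeastAtMost_iff int_one_le_iff_zero_less not_le)
qed

lemma S_inf_bound:
  assumes "v \<in> S_inf"
  obtains q where "\<forall>j>q. v j = j"
proof -
  have "finite {i. v i \<noteq> i}"
    using assms by (simp add: S_inf_def)
  then have "bdd_above {i. v i \<noteq> i}"
    by (rule bdd_above_finite)
  then obtain q where q: "\<And>i. v i \<noteq> i \<Longrightarrow> i \<le> q"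
    by (auto simp: bdd_above_def)
  show thesis
  proof (rule that)
    show "\<forall>j>q. v j = j"
      using q leD by blast
  qed
qed

lemma inversions_subset:
  assumes "v \<in> S_inf" "\<forall>j>q. v j = j"
  shows "{(a, b). a < b \<and> v b < v a} \<subseteq> {1..q} \<times> {1..q}"
proof clarify
  fix a b :: int
  assume ab: "a < b" "v b < v a"
  have fix0: "\<forall>i\<le>0. v i = i"
    using assms(1) by (auto simp: S_inf_def)
  have in_q: "j \<in> {1..q} \<Longrightarrow> v j \<in> {1..q}" for j
    by (rule S_inf_interval[OF assms])
  have "1 \<le> a"
  proof (rule ccontr)
    assume "\<not> 1 \<le> a"
    then have "v a = a" "a \<le> 0" using fix0 by auto
    moreover have "v b = b \<or> 1 \<le> v b"
      using fix0 in_q[of b] assms(2) by (cases "b \<le> 0"; cases "b > q") auto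
    ultimately show False using ab by auto
  qed
  moreover have "b \<le> q"
  proof (rule ccontr)
    assume "\<not> b \<le> q"
    then have "v b = b" "b > q" using assms(2) by auto
    moreover have "v a = a \<or> v a \<le> q"
      using in_q[of a] assms(2) \<open>1 \<le> a\<close> by (cases "a > q") auto
    ultimately show False using ab by auto
  qed
  ultimately show "a \<in> {1..q} \<and> b \<in> {1..q}" using ab by auto
qed

lemma finite_inversions:
  assumes "v \<in> S_inf"
  shows "finite {(a, b). a < b \<and> v b < v a}"
proof -
  obtain q where "\<forall>j>q. v j = j"
    by (rule S_inf_bound[OF assms])
  from inversions_subset[OF assms this] show ?thesis
    by (rule finite_subset) simp
qed

text \<open>A crude bound; it makes the length-increasing climb to \<open>dom_perm\<close>
  stop.\<close>

lemma perm_length_le: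
  assumes "v \<in> S_inf" "\<forall>j>q. v j = j"
  shows "perm_length v \<le> nat q * nat q"
  using card_mono[OF _ inversions_subset[OF assms]]
  by (simp add: perm_length_def card_cartesian_product)

section \<open>Conjugation by an adjacent transposition: length and openers\<close>

lemma conj_S_inf:
  assumes "v \<in> S_inf" "0 < i"
  shows "s i \<circ> v \<circ> s i \<in> S_inf"
proof -
  have "{j. (s i \<circ> v \<circ> s i) j \<noteq> j} \<subseteq> insert i (insert (i + 1) {j. v j \<noteq> j})"
    by (auto simp: transpose_def)
  moreover have "finite (insert i (insert (i + 1) {j. v j \<noteq> j}))"
    using assms by (auto simp: S_inf_def)
  ultimately have "finite {j. (s i \<circ> v \<circ> s i) j \<noteq> j}"
    by (rule finite_subset)
  moreover have "bij (s i \<circ> v \<circ> s i)"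
    using assms(1) by (intro bij_comp) (simp_all add: S_inf_def)
  moreover have "(s i \<circ> v \<circ> s i) j = j" if "j \<le> 0" for j
    using that assms by (simp add: S_inf_def transpose_def)
  ultimately show ?thesis
    unfolding S_inf_def by blast
qed

lemma conj_involution:
  assumes "v \<circ> v = id"
  shows "(s i \<circ> v \<circ> s i) \<circ> (s i \<circ> v \<circ> s i) = id"
  using assms by (auto simp: fun_eq_iff)

text \<open>The order could flip only for \<open>v b = i\<close> and \<open>v a = i + 1\<close>,
  that is \<open>b = v i\<close> and \<open>a = v (i + 1)\<close>; then \<open>a < b\<close>
  contradicts the ascent at \<open>i\<close>.\<close>

lemma s_value_less:
  assumes "v \<circ> v = id" "v i < v (i + 1)" "a < b" "v b < v a"
  shows "s i (v b) < s i (v a)"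
proof (rule s_less[OF assms(4)])
  have "b = v (v b)" "a = v (v a)"
    using assms(1) by (simp_all add: fun_eq_iff)
  then show "\<not> (v b = i \<and> v a = i + 1)"
    using assms by auto
qed

lemma s_ascent_less:
  assumes "v \<circ> v = id" "v i < v (i + 1)" "v i \<noteq> i \<or> v (i + 1) \<noteq> i + 1"
  shows "s i (v i) < s i (v (i + 1))"
  using assms by (intro s_less) auto

text \<open>Applying \<open>s i\<close> to both positions injects the inversions of \<open>v\<close>
  into those of the conjugate and misses the inversion \<open>(i, i + 1)\<close>.\<close>

lemma perm_length_conj_less:
  assumes v: "v \<in> S_inf" "v \<circ> v = id" and "0 < i"
    and asc: "v i < v (i + 1)" "v i \<noteq> i \<or> v (i + 1) \<noteq> i + 1"
  shows "perm_length v < perm_length (s i \<circ> v \<circ> s i)"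
proof -
  define w where "w = s i \<circ> v \<circ> s i"
  let ?I = "\<lambda>f :: int \<Rightarrow> int. {(a, b). a < b \<and> f b < f a}"
  let ?g = "map_prod (s i) (s i)"
  have "?g ` ?I v \<subseteq> ?I w"
  proof clarsimp
    fix a b :: int
    assume ab: "a < b" "v b < v a"
    have "s i a < s i b"
      using ab asc by (intro s_less) auto
    then show "s i a < s i b \<and> w (s i b) < w (s i a)"
      using s_value_less[OF v(2) asc(1) ab] by (simp add: w_def)
  qed
  moreover have "(i, i + 1) \<in> ?I w"
    using s_ascent_less[OF v(2) asc] by (simp add: w_def)
  moreover have "(i, i + 1) \<notin> ?g ` ?I v"
  proof
    assume "(i, i + 1) \<in> ?g ` ?I v"
    then obtain a b where "a < b" "s i a = i" "s i b = i + 1" by auto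
    then show False
      by (metis less_le_not_le transpose_apply_first transpose_involutory zle_add1_eq_le
          order_refl transpose_apply_second)
  qed
  ultimately have "?g ` ?I v \<subset> ?I w" by blast
  moreover have "finite (?I w)"
    unfolding w_def by (intro finite_inversions conj_S_inf v(1) \<open>0 < i\<close>)
  ultimately have "card (?g ` ?I v) < card (?I w)"
    by (simp add: psubset_card_mono)
  moreover have "card (?g ` ?I v) = card (?I v)"
    by (intro card_image) (auto intro!: inj_onI dest!: injD[OF inj_transpose])
  ultimately show ?thesis by (simp add: perm_length_def w_def)
qed

text \<open>At a descent, either \<open>v\<close> swaps \<open>i\<close> and \<open>i + 1\<close>
  and conjugation does nothing, or the conjugate has a nontrivial ascent at \<open>i\<close> and
  conjugating back raises the length.\<close>

lemma perm_length_conj_lessD: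
  assumes v: "v \<in> S_inf" "v \<circ> v = id" and "0 < i"
    and less: "perm_length v < perm_length (s i \<circ> v \<circ> s i)"
  shows "v i < v (i + 1)"
proof (rule ccontr)
  assume "\<not> v i < v (i + 1)"
  moreover have "v i \<noteq> v (i + 1)"
    using v(1) by (auto simp: S_inf_def bij_def dest: injD)
  ultimately have desc: "v (i + 1) < v i" by simp
  let ?w = "s i \<circ> v \<circ> s i"
  have w: "s i \<circ> ?w \<circ> s i = v"
    by (auto simp: fun_eq_iff)
  show False
  proof (cases "v (i + 1) = i \<and> v i = i + 1")
    case True
    moreover have "v j \<noteq> i \<and> v j \<noteq> i + 1" if "j \<noteq> i" "j \<noteq> i + 1" for j
      using that v(2) True by (metis comp_apply id_apply)
    ultimately have "?w = v"
      by (auto simp: fun_eq_iff transpose_def)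
    then show False using less by simp
  next
    case False
    have "?w i < ?w (i + 1)"
      using s_less[OF desc, of i] False by simp
    moreover have "?w i \<noteq> i \<or> ?w (i + 1) \<noteq> i + 1"
      using desc by (auto simp: transpose_def split: if_splits)
    ultimately have "perm_length ?w < perm_length (s i \<circ> ?w \<circ> s i)"
      by (intro perm_length_conj_less conj_S_inf conj_involution v \<open>0 < i\<close>)
    then have "perm_length ?w < perm_length v"
      unfolding w .
    then show False using less by simp
  qed
qed

text \<open>Conjugation moves the 2-cycle of \<open>j\<close> and \<open>v j\<close> to that of
  \<open>s i j\<close> and \<open>s i (v j)\<close>. The order within it could flip only for the
  2-cycle of \<open>i\<close> and \<open>i + 1\<close>, which an ascent at \<open>i\<close>
  excludes.\<close>

lemma openers_conj:
  assumes v: "v \<circ> v = id" "\<forall>j\<le>0. v j = j" and "0 < i" and asc: "v i < v (i + 1)"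
  shows "openers (s i \<circ> v \<circ> s i) = s i ` openers v"
proof -
  define w where "w = s i \<circ> v \<circ> s i"
  have vv: "v (v x) = x" for x
    using v(1) by (simp add: fun_eq_iff)
  have "v i \<noteq> i + 1"
    using asc vv[of i] by auto
  moreover have "v (i + 1) \<noteq> i"
    using asc vv[of "i + 1"] by auto
  ultimately have ne: "v i \<noteq> i + 1" "w i \<noteq> i + 1"
    by (auto simp: w_def transpose_def split: if_splits)
  have pos: "0 < s i j \<longleftrightarrow> 0 < j" for j
    using \<open>0 < i\<close> by (auto simp: transpose_def)
  have "s i j \<in> openers w" if "j \<in> openers v" for j
    using that ne s_less[of j "v j" i] by (auto simp: openers_def pos w_def)
  moreover have "s i j \<in> openers v" if "j \<in> openers w" for j
    using that ne s_less[of j "w j" i] by (auto simp: openers_def pos w_def)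
  then have "j \<in> s i ` openers v" if "j \<in> openers w" for j
    using that by (metis image_eqI transpose_involutory)
  ultimately show ?thesis unfolding w_def by blast
qed

section \<open>Vexillarity and the patterns 2134 and 1243\<close>

lemma vexillaryD:
  "vexillary f \<Longrightarrow> a < b \<Longrightarrow> b < c \<Longrightarrow> c < d \<Longrightarrow> f b < f a \<Longrightarrow> f a < f d \<Longrightarrow> f d < f c \<Longrightarrow> False"
  unfolding vexillary_def by blast

text \<open>The pattern 2143 is its own inverse, so exchanging positions and values turns an
  occurrence in \<open>g\<close> into one in \<open>f\<close>.\<close>

lemma vexillary_inverse:
  assumes "vexillary f" "f \<circ> g = id"
  shows "vexillary g"
  unfolding vexillary_def
proof clarify
  fix a b c d
  assume "a < b" "b < c" "c < d" "g b < g a" "g a < g d" "g d < g c"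
  moreover have "f (g x) = x" for x
    using assms(2) by (simp add: fun_eq_iff)
  ultimately show False
    using vexillaryD[OF assms(1), of "g b" "g a" "g d" "g c"] by simp
qed

text \<open>A new 2143-pattern must use both \<open>i\<close> and \<open>i + 1\<close>. As these now
  form a descent, they play 43 or 21, which comes from a 2134- or a 1243-pattern of
  \<open>f\<close>.\<close>

lemma vexillary_comp_s:
  assumes f: "vexillary f" and asc: "f i < f (i + 1)"
    and no2134: "\<And>a b. a < b \<Longrightarrow> b < i \<Longrightarrow> f b < f a \<Longrightarrow> f a < f i \<Longrightarrow> False"
    and no1243: "\<And>c d. i + 1 < c \<Longrightarrow> c < d \<Longrightarrow> f d < f c \<Longrightarrow> f (i + 1) < f d \<Longrightarrow> False"
  shows "vexillary (f \<circ> s i)"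
  unfolding vexillary_def
proof clarify
  fix a b c d
  let ?g = "f \<circ> s i"
  assume ord: "a < b" "b < c" "c < d"
    and vals: "?g b < ?g a" "?g a < ?g d" "?g d < ?g c"
  consider "a = i \<and> b = i + 1" | "c = i \<and> d = i + 1" | "b = i \<and> c = i + 1"
    | "\<not> (a = i \<and> b = i + 1)" "\<not> (c = i \<and> d = i + 1)" "\<not> (b = i \<and> c = i + 1)" by blast
  then show False
  proof cases
    case 1
    then show False using ord vals no1243[of c d] by simp
  next
    case 2
    then show False using ord vals no2134[of a b] by simp
  next
    case 3
    then show False using vals asc by simp
  next
    case 4
    then show False
      using vexillaryD[OF f, of "s i a" "s i b" "s i c" "s i d"] ord vals by (simp add: s_less)
  qed
qed

text \<open>Conjugation is done in two one-sided steps: \<open>v \<circ> s i\<close> is vexillary,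
  hence so is its inverse \<open>s i \<circ> v\<close>, to which the one-sided criterion applies
  again.\<close>

lemma vexillary_conj:
  assumes v: "vexillary v" "v \<circ> v = id"
    and asc: "v i < v (i + 1)" "v i \<noteq> i \<or> v (i + 1) \<noteq> i + 1"
    and no2134: "\<And>a b. a < b \<Longrightarrow> b < i \<Longrightarrow> v b < v a \<Longrightarrow> v a < v i \<Longrightarrow> False"
    and no1243: "\<And>c d. i + 1 < c \<Longrightarrow> c < d \<Longrightarrow> v d < v c \<Longrightarrow> v (i + 1) < v d \<Longrightarrow> False"
  shows "vexillary (s i \<circ> v \<circ> s i)"
proof (rule vexillary_comp_s)
  let ?g = "s i \<circ> v"
  have vv: "v (v x) = x" for x
    using v(2) by (simp add: fun_eq_iff)
  have "vexillary (v \<circ> s i)"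
    using v(1) asc(1) no2134 no1243 by (rule vexillary_comp_s)
  moreover have "(v \<circ> s i) \<circ> ?g = id"
    using vv by (auto simp: fun_eq_iff)
  ultimately show "vexillary ?g"
    by (rule vexillary_inverse)
  show "?g i < ?g (i + 1)"
    using s_ascent_less[OF v(2) asc] by simp
  \<comment> \<open>\<open>v\<close> and \<open>s i \<circ> v\<close> order the values at two positions differently only if these are
    \<open>v i\<close> and \<open>v (i + 1)\<close>, where \<open>s i \<circ> v\<close> has a descent.\<close>
  have less: "v x < v y" if "x < y" "?g x < ?g y" for x y
    using that s_value_less[OF v(2) asc(1) that(1)] vv by (metis comp_apply less_asym linorder_neqE)
  have greater: "v y < v x \<or> x = v i \<and> y = v (i + 1)" if "x < y" "?g y < ?g x" for x y
    using that s_less[of "v x" "v y" i] vv by (metis comp_apply less_asym linorder_neqE)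
  show False if "a < b" "b < i" "?g b < ?g a" "?g a < ?g i" for a b
    using greater[OF that(1,3)]
  proof
    assume "v b < v a"
    then show False using no2134[OF that(1,2)] less[OF _ that(4)] that by simp
  next
    \<comment> \<open>Since \<open>a < i\<close>, here \<open>?g i = a\<close>, whereas
      \<open>?g a = i + 1\<close>; this contradicts \<open>?g a < ?g i\<close>.\<close>
    assume "a = v i \<and> b = v (i + 1)"
    then show False using that vv by simp
  qed
  show False if "i + 1 < c" "c < d" "?g d < ?g c" "?g (i + 1) < ?g d" for c d
    using greater[OF that(2,3)]
  proof
    assume "v d < v c"
    then show False using no1243[OF that(1,2)] less[OF _ that(4)] that by simp
  next
    assume "c = v i \<and> d = v (i + 1)"
    then show False using that vv by simp
  qed
qed

section \<open>Choosing an ascent that preserves vexillarity\<close>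

lemma vexillary_conj_exists:
  assumes v: "v \<in> vex_involutions" and fixq: "\<forall>j>q. v j = j"
    and nontrivial: "\<exists>i\<in>{1..q - 1}. v i < v (i + 1) \<and> (v i \<noteq> i \<or> v (i + 1) \<noteq> i + 1)"
  shows "\<exists>i\<in>{1..q - 1}. v i < v (i + 1) \<and> (v i \<noteq> i \<or> v (i + 1) \<noteq> i + 1) \<and>
    vexillary (s i \<circ> v \<circ> s i)"
proof -
  have S: "v \<in> S_inf" and inv: "v \<circ> v = id" and vex: "vexillary v"
    using v by (auto simp: vex_involutions_def)
  have inv_bounds: "1 \<le> a" "b \<le> q" if "a < b" "v b < v a" for a b
    using inversions_subset[OF S fixq] that by auto
  \<comment> \<open>The bound \<open>1 \<le> e\<close> matters: together with the fixed point 0, any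
    inversion would form a 132-pattern.\<close>
  show ?thesis
  proof (cases "\<exists>e c d. 1 \<le> e \<and> e < c \<and> c < d \<and> v e < v d \<and> v d < v c")
    case True
    let ?D = "{d. \<exists>e c. 1 \<le> e \<and> e < c \<and> c < d \<and> v e < v d \<and> v d < v c}"
    have "?D \<subseteq> {1..q}" using inv_bounds by force
    then have "finite (v ` ?D)" using finite_subset by blast
    moreover have "v ` ?D \<noteq> {}" using True by blast
    ultimately have "Max (v ` ?D) \<in> v ` ?D" "\<forall>d\<in>?D. v d \<le> Max (v ` ?D)"
      by (auto intro: Max_in)
    then obtain d where d: "d \<in> ?D" and max: "\<forall>d'\<in>?D. v d' \<le> v d"
      by (metis (no_types, lifting) imageE)
    then obtain e c where e: "1 \<le> e" "e < c" "c < d" "v e < v d" "v d < v c" by auto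
    then obtain i where i: "e \<le> i" "i < c" "v i < v d" "\<not> v (i + 1) < v d"
      using ex_step_int[of e c "\<lambda>j. v j < v d"] by auto
    have "v (i + 1) \<noteq> v d"
      using i e S by (auto simp: S_inf_def bij_def dest!: injD)
    \<comment> \<open>The integer \<open>v d\<close> lies strictly between \<open>v i\<close> and
      \<open>v (i + 1)\<close>, so \<open>i\<close> and \<open>i + 1\<close> are not both
      fixed.\<close>
    then have gt: "v d < v (i + 1)" using i by simp
    have "c \<le> q" using inv_bounds[of c d] e by simp
    moreover have "vexillary (s i \<circ> v \<circ> s i)"
    proof (rule vexillary_conj[OF vex inv])
      \<comment> \<open>A 2134-pattern ending at \<open>i\<close>, \<open>i + 1\<close> would give
        the 2143-pattern \<open>a\<close>, \<open>b\<close>, \<open>c\<close>,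
        \<open>d\<close>.\<close>
      show False if "a < b" "b < i" "v b < v a" "v a < v i" for a b
        using vexillaryD[OF vex, of a b c d] that i e by simp
      show False if "i + 1 < c'" "c' < d'" "v d' < v c'" "v (i + 1) < v d'" for c' d'
      proof -
        \<comment> \<open>The 132-pattern \<open>i\<close>, \<open>c'\<close>, \<open>d'\<close> has
          \<open>v d' > v d\<close>, against the maximality of \<open>v d\<close>.\<close>
        have "d' \<in> ?D"
          using that i e gt by (intro CollectI exI[of _ i] exI[of _ c']) auto
        then show False using max that gt by force
      qed
    qed (use i gt in auto)
    ultimately show ?thesis
      using i e gt by (intro bexI[of _ i]) auto
  next
    case dominant: False
    let ?P = "\<lambda>i. 1 \<le> i \<and> i \<le> q - 1 \<and> v i < v (i + 1) \<and> (v i \<noteq> i \<or> v (i + 1) \<noteq> i + 1)"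
    let ?A = "{i. ?P i}"
    have "?A \<subseteq> {1..q}" by auto
    then have fin: "finite ?A" using finite_subset by blast
    have ne: "?A \<noteq> {}" using nontrivial by auto
    define i where "i = Min ?A"
    have "i \<in> ?A" unfolding i_def using fin ne by (rule Min_in)
    then have i: "?P i" by simp
    have least: "i \<le> j" if "?P j" for j
      unfolding i_def using fin that by (intro Min_le) auto
    have "vexillary (s i \<circ> v \<circ> s i)"
    proof (rule vexillary_conj[OF vex inv])
      show False if ab: "a < b" "b < i" "v b < v a" "v a < v i" for a b
      proof -
        \<comment> \<open>The values climb past \<open>v a\<close> between \<open>b\<close> and
          \<open>i\<close>. The crossing is a nontrivial ascent because \<open>v a\<close> lies
          strictly between its two values, and it precedes the least one.\<close>
        obtain j where j: "b \<le> j" "j < i" "v j < v a" "\<not> v (j + 1) < v a"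
          using ex_step_int[of b i "\<lambda>j. v j < v a"] ab by auto
        have "v (j + 1) \<noteq> v a"
          using S j ab by (auto simp: S_inf_def bij_def dest!: injD)
        then have "?P j"
          using j i inv_bounds[of a b] ab by auto
        then show False using least[of j] j by simp
      qed
      show False if "i + 1 < c" "c < d" "v d < v c" "v (i + 1) < v d" for c d
      proof -
        have "1 \<le> i \<and> i < c \<and> c < d \<and> v i < v d \<and> v d < v c" using that i by simp
        then show False using dominant by blast
      qed
    qed (use i in auto)
    then show ?thesis using i by auto
  qed
qed

section \<open>Dominant involutions as end points of the climb\<close>

lemma dom_perm_apply:
  assumes "0 \<le> p" "2 * p \<le> q"
  shows "dom_perm p q j = (if j \<in> {1..p} \<union> {q - p + 1..q} then q + 1 - j else j)"
proof -
  have foldr_comp: "foldr (\<circ>) (xs @ [g]) id = foldr (\<circ>) xs id \<circ> g" for xs :: "(int \<Rightarrow> int) list" and g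
    by (induction xs) auto
  have "2 * p \<le> q \<longrightarrow>
      (\<forall>j. dom_perm p q j = (if j \<in> {1..p} \<union> {q - p + 1..q} then q + 1 - j else j))"
    using assms(1)
  proof (induction p rule: int_ge_induct)
    case base
    then show ?case by (auto simp: dom_perm_def)
  next
    case (step p)
    have "[1..p + 1] = [1..p] @ [p + 1]"
      using step.hyps by (simp add: upto_rec2)
    \<comment> \<open>For \<open>2 * (p + 1) \<le> q\<close> the new factor swaps two points fixed
      by all earlier factors.\<close>
    then have "dom_perm (p + 1) q = dom_perm p q \<circ> transpose (p + 1) (q - p)"
      by (simp add: dom_perm_def foldr_comp del: foldr_append)
    then show ?case
      using step by (auto simp: transpose_def)
  qed
  then show ?thesis using assms(2) by blast
qed

text \<open>Counting the positions to the right of a non-fixed \<open>j\<close> gives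
  \<open>v j = q + 1 - j\<close>. No positive fixed point precedes an opener, so the openers form an
  initial segment, and they determine \<open>v\<close>.\<close>

lemma eq_dom_perm:
  assumes S: "v \<in> S_inf" and inv: "v \<circ> v = id" and fixq: "\<forall>j>q. v j = j" and "0 \<le> q"
    and trivial: "\<And>i. i \<in> {1..q - 1} \<Longrightarrow> v i < v (i + 1) \<Longrightarrow> v i = i \<and> v (i + 1) = i + 1"
  shows "v = dom_perm (int (card (openers v))) q"
proof -
  have vv: "v (v x) = x" for x
    using inv by (simp add: fun_eq_iff)
  have inj: "v x = v y \<longleftrightarrow> x = y" for x y
    using vv by metis
  have in_q: "j \<in> {1..q} \<Longrightarrow> v j \<in> {1..q}" for j
    by (rule S_inf_interval[OF S fixq])
  have fix0: "\<forall>i\<le>0. v i = i"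
    using S by (auto simp: S_inf_def)
  \<comment> \<open>Between \<open>j\<close> and \<open>k\<close> every value in \<open>(v j, v k]\<close> is crossed at a trivial ascent.\<close>
  have both_fixed: "v j = j \<and> v k = k" if jk: "1 \<le> j" "j < k" "k \<le> q" "v j < v k" for j k
  proof -
    have x_fixed: "v x = x \<and> v (x - 1) = x - 1" if x: "v j < x" "x \<le> v k" for x
    proof -
      obtain i where i: "j \<le> i" "i < k" "v i < x" "\<not> v (i + 1) < x"
        using ex_step_int[of j k "\<lambda>i. v i < x"] jk x by auto
      then have "v i = i \<and> v (i + 1) = i + 1"
        using trivial[of i] jk by simp
      moreover from this have "x = i + 1" using i by simp
      ultimately show ?thesis by simp
    qed
    \<comment> \<open>Level \<open>v j + 1\<close> shows that \<open>v j\<close> is fixed and level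
      \<open>v k\<close> that \<open>v k\<close> is fixed; hence so are \<open>j\<close> and
      \<open>k\<close>.\<close>
    show ?thesis
      using x_fixed[of "v j + 1"] x_fixed[of "v k"] jk vv by simp
  qed
  have reversed: "v j = q + 1 - j" if j: "j \<in> {1..q}" "v j \<noteq> j" for j
  proof -
    have smaller: "v k < v j \<longleftrightarrow> j < k" if "k \<in> {1..q}" for k
    proof (cases j k rule: linorder_cases)
      case less
      then have "\<not> v j < v k" "v j \<noteq> v k"
        using both_fixed[of j k] that j inj[of j k] by auto
      then show ?thesis using less by simp
    next
      case greater
      then show ?thesis using both_fixed[of k j] that j by auto
    qed simp
    \<comment> \<open>The positions after \<open>j\<close> carry exactly the values below
      \<open>v j\<close>; comparing cardinalities yields \<open>q - j = v j - 1\<close>.\<close>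
    have "v ` {j + 1..q} = {1..v j - 1}"
    proof (intro equalityI subsetI)
      fix x assume "x \<in> v ` {j + 1..q}"
      then show "x \<in> {1..v j - 1}"
        using smaller in_q j(1) by force
    next
      fix x assume x: "x \<in> {1..v j - 1}"
      then have "x \<in> {1..q}" using in_q[OF j(1)] by auto
      then have "v x \<in> {j + 1..q}"
        using smaller[of "v x"] x in_q[of x] vv by auto
      then show "x \<in> v ` {j + 1..q}" using vv by (metis image_eqI)
    qed
    moreover have "card (v ` {j + 1..q}) = card {j + 1..q}"
      by (intro card_image inj_onI) (simp add: inj)
    ultimately have "nat (q - j) = nat (v j - 1)" by simp
    then show ?thesis using j(1) in_q[OF j(1)] by auto
  qed
  have openers_eq: "openers v = {j \<in> {1..q}. v j \<noteq> j \<and> 2 * j < q + 1}"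
  proof (intro set_eqI)
    fix j show "j \<in> openers v \<longleftrightarrow> j \<in> {j \<in> {1..q}. v j \<noteq> j \<and> 2 * j < q + 1}"
      using reversed[of j] fixq by (cases "j \<le> q") (auto simp: openers_def)
  qed
  have down: "f \<in> openers v" if f: "1 \<le> f" "f < j" and j: "j \<in> openers v" for f j
  proof (rule ccontr)
    assume "f \<notin> openers v"
    moreover have jq: "j \<in> {1..q}" "v j \<noteq> j" "2 * j < q + 1" using j openers_eq by auto
    ultimately have "v f = f" using f openers_eq by auto
    moreover have "v j = q + 1 - j" using reversed jq by blast
    ultimately show False
      using both_fixed[of f j] f jq by auto
  qed
  define p where "p = int (card (openers v))"
  have fin: "finite (openers v)"
    unfolding openers_eq by (rule finite_subset[of _ "{1..q}"]) auto
  have initial: "openers v = {1..p}"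
  proof (cases "openers v = {}")
    case True
    then show ?thesis by (simp add: p_def)
  next
    case False
    define m where "m = Max (openers v)"
    have m: "m \<in> openers v" "\<And>x. x \<in> openers v \<Longrightarrow> x \<le> m"
      unfolding m_def using fin False by simp_all
    have pos: "0 < x" if "x \<in> openers v" for x
      using that by (simp add: openers_def)
    have "x \<in> openers v \<longleftrightarrow> x \<in> {1..m}" for x
      using m pos[of x] down[of x m] by (cases "x = m") auto
    then have "openers v = {1..m}"
      by blast
    moreover from this have "card (openers v) = nat m"
      by simp
    moreover have "0 < m" using m(1) by (rule pos)
    ultimately show ?thesis unfolding p_def by simp
  qed
  have pq: "0 \<le> p" "2 * p \<le> q"
  proof -
    show "0 \<le> p" by (simp add: p_def)
    show "2 * p \<le> q"
    proof (cases "p = 0")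
      case False
      then have "p \<in> openers v" using initial \<open>0 \<le> p\<close> by simp
      then show ?thesis using openers_eq by auto
    qed (use \<open>0 \<le> q\<close> in simp)
  qed
  have opener_val: "v j = q + 1 - j" if "j \<in> {1..p}" for j
    using that initial openers_eq reversed by blast
  have "v j = dom_perm p q j" for j
  proof (cases "j \<in> {1..p} \<union> {q - p + 1..q}")
    case True
    \<comment> \<open>The upper block consists of the partners of the openers.\<close>
    moreover have "v j = q + 1 - j" if "j \<in> {q - p + 1..q}"
      using opener_val[of "q + 1 - j"] that vv[of "q + 1 - j"] by simp
    ultimately show ?thesis
      using opener_val dom_perm_apply[OF pq] by auto
  next
    case False
    have "v j = j"
    proof (rule ccontr)
      assume nf: "v j \<noteq> j"
      then have j: "j \<in> {1..q}"
        using fixq fix0 by (metis atLeastAtMost_iff int_one_le_iff_zero_less not_le)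
      then have vj: "v j = q + 1 - j" using reversed nf by blast
      show False
      proof (cases "2 * j < q + 1")
        case True
        then have "j \<in> openers v" using openers_eq nf j by simp
        then show False using False initial by simp
      next
        \<comment> \<open>Equality \<open>2 * j = q + 1\<close> would make \<open>j\<close> fixed,
          so \<open>j\<close> is the larger element of its 2-cycle.\<close>
        case ge: False
        then have "v j \<in> openers v"
          using openers_eq nf j vj vv[of j] in_q[OF j] by auto
        then show False using False initial vj by simp
      qed
    qed
    then show ?thesis using False dom_perm_apply[OF pq] by auto
  qed
  then show ?thesis by (simp add: fun_eq_iff p_def)
qed

section \<open>Paths in the vexillary weak order graph\<close>

lemma tail_vex_graph [simp]: "tail vex_graph (v, i, w) = v"
  and head_vex_graph [simp]: "head vex_graph (v, i, w) = w"
  by (simp_all add: vex_graph_def)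

lemma verts_vex_graph [simp]: "verts vex_graph = vex_involutions"
  by (simp add: vex_graph_def)

lemma arcs_vex_graph:
  "(v, i, w) \<in> arcs vex_graph \<longleftrightarrow> v \<in> vex_involutions \<and> w \<in> vex_involutions \<and> 0 < i \<and>
    w = s i \<circ> v \<circ> s i \<and> perm_length v < perm_length w"
  by (simp add: vex_graph_def)

lemma wf_digraph_vex_graph: "wf_digraph vex_graph"
  by standard (auto simp: vex_graph_def)

lemma apath_vex_graph_Cons:
  "pre_digraph.apath vex_graph u (e # es) w \<longleftrightarrow>
    (\<exists>i. e = (u, i, s i \<circ> u \<circ> s i) \<and> e \<in> arcs vex_graph \<and>
      pre_digraph.apath vex_graph (s i \<circ> u \<circ> s i) es w \<and>
      u \<notin> set (pre_digraph.awalk_verts vex_graph (s i \<circ> u \<circ> s i) es))"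
proof -
  interpret wf_digraph vex_graph
    by (rule wf_digraph_vex_graph)
  show ?thesis
    by (cases e) (auto simp: apath_Cons_iff arcs_vex_graph)
qed

text \<open>Every edge raises the length. This keeps a vertex prepended to a path from recurring on
  it, as \<open>apath\<close> demands distinct vertices.\<close>

lemma apath_vex_graph_perm_length:
  assumes "pre_digraph.apath vex_graph u es w" "v \<in> set (pre_digraph.awalk_verts vex_graph u es)"
  shows "perm_length u \<le> perm_length v"
  using assms
proof (induction es arbitrary: u)
  case Nil
  then show ?case by (simp add: pre_digraph.awalk_verts.simps)
next
  case (Cons e es)
  then obtain i where i: "e = (u, i, s i \<circ> u \<circ> s i)" "e \<in> arcs vex_graph"
      "pre_digraph.apath vex_graph (s i \<circ> u \<circ> s i) es w"
    unfolding apath_vex_graph_Cons by blast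
  then have "perm_length u < perm_length (s i \<circ> u \<circ> s i)"
    by (simp add: arcs_vex_graph)
  moreover have "v = u \<or> v \<in> set (pre_digraph.awalk_verts vex_graph (s i \<circ> u \<circ> s i) es)"
    using Cons.prems(2) i(1) by (simp add: pre_digraph.awalk_verts.simps)
  ultimately show ?case
    using Cons.IH[OF i(3)] by fastforce
qed

text \<open>Each conjugation at a suitable ascent uses up some of the bounded room for length, and
  keeps both the fixed points above \<open>q\<close> and the number of openers. The end point is
  thus already determined by \<open>v\<close>.\<close>

lemma apath_to_dom_perm:
  assumes "v \<in> vex_involutions" "\<forall>j>q. v j = j" "0 \<le> q"
  shows "\<exists>es. pre_digraph.apath vex_graph v es (dom_perm (int (card (openers v))) q) \<and>
    edge_labels es \<subseteq> {1..q - 1}"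
  using assms(1,2)
proof (induction "nat q * nat q - perm_length v" arbitrary: v rule: less_induct)
  case less
  interpret wf_digraph vex_graph
    by (rule wf_digraph_vex_graph)
  have S: "v \<in> S_inf" and inv: "v \<circ> v = id"
    using less.prems by (auto simp: vex_involutions_def)
  show ?case
  proof (cases "\<exists>i\<in>{1..q - 1}. v i < v (i + 1) \<and> (v i \<noteq> i \<or> v (i + 1) \<noteq> i + 1)")
    case True
    then obtain i where i: "i \<in> {1..q - 1}" and asc: "v i < v (i + 1)" "v i \<noteq> i \<or> v (i + 1) \<noteq> i + 1"
      and vex: "vexillary (s i \<circ> v \<circ> s i)"
      using vexillary_conj_exists[OF less.prems] by blast
    let ?w = "s i \<circ> v \<circ> s i"
    have "0 < i" using i by simp
    have w: "?w \<in> vex_involutions"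
      using conj_S_inf[OF S \<open>0 < i\<close>] conj_involution[OF inv] vex
      by (simp add: vex_involutions_def)
    have wq: "\<forall>j>q. ?w j = j"
      using less.prems(2) i by (simp add: transpose_def)
    have len: "perm_length v < perm_length ?w"
      using perm_length_conj_less[OF S inv \<open>0 < i\<close> asc] .
    moreover have "perm_length ?w \<le> nat q * nat q"
      using perm_length_le[OF conj_S_inf[OF S \<open>0 < i\<close>] wq] .
    ultimately have "nat q * nat q - perm_length ?w < nat q * nat q - perm_length v"
      by simp
    then obtain es where es: "apath ?w es (dom_perm (int (card (openers ?w))) q)"
        "edge_labels es \<subseteq> {1..q - 1}"
      using less.hyps w wq by blast
    have "openers ?w = s i ` openers v"
      using S openers_conj[OF inv _ \<open>0 < i\<close> asc(1)] by (simp add: S_inf_def)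
    then have "card (openers ?w) = card (openers v)"
      by (simp only: card_image[OF inj_on_transpose])
    moreover have "v \<notin> set (awalk_verts ?w es)"
      using apath_vex_graph_perm_length[OF es(1)] len by force
    moreover have "(v, i, ?w) \<in> arcs vex_graph"
      using less.prems(1) w len \<open>0 < i\<close> by (simp add: arcs_vex_graph)
    ultimately have "apath v ((v, i, ?w) # es) (dom_perm (int (card (openers v))) q)"
      using es(1) by (simp add: apath_vex_graph_Cons)
    moreover have "edge_labels ((v, i, ?w) # es) \<subseteq> {1..q - 1}"
      using es(2) i by (simp add: edge_labels_def)
    ultimately show ?thesis by blast
  next
    case False
    then have "v = dom_perm (int (card (openers v))) q"
      using eq_dom_perm[OF S inv less.prems(2) assms(3)] by blast
    moreover have "apath v [] v"
      using less.prems(1) by (simp add: apath_Nil_iff)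
    ultimately show ?thesis
      by (intro exI[of _ "[]"]) (simp add: edge_labels_def)
  qed
qed

text \<open>If the openers are \<open>1, \<dots>, p\<close> then \<open>v (p + 1) \<le> p + 1 \<le> v p\<close>, so \<open>p\<close> is a descent, and
  conjugation by any other \<open>s i\<close> preserves the set of openers.\<close>

lemma apath_avoids_label:
  assumes "pre_digraph.apath vex_graph v es w" "openers v = {1..p}" "0 \<le> p"
  shows "p \<notin> edge_labels es"
  using assms(1,2)
proof (induction es arbitrary: v)
  case Nil
  then show ?case by (simp add: edge_labels_def)
next
  case (Cons e es)
  then obtain i where e: "e = (v, i, s i \<circ> v \<circ> s i)" "e \<in> arcs vex_graph"
      and es: "pre_digraph.apath vex_graph (s i \<circ> v \<circ> s i) es w"
    unfolding apath_vex_graph_Cons by blast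
  then have v: "v \<in> S_inf" "v \<circ> v = id" and "0 < i"
      and less: "perm_length v < perm_length (s i \<circ> v \<circ> s i)"
    by (auto simp: arcs_vex_graph vex_involutions_def)
  have asc: "v i < v (i + 1)"
    using perm_length_conj_lessD[OF v \<open>0 < i\<close> less] .
  have "i \<noteq> p"
  proof
    assume "i = p"
    then have "i \<in> openers v" "i + 1 \<notin> openers v"
      using Cons.prems(2) \<open>0 < i\<close> by auto
    then have "i < v i" "v (i + 1) \<le> i + 1"
      using \<open>0 < i\<close> by (auto simp: openers_def)
    then show False using asc by simp
  qed
  have "openers (s i \<circ> v \<circ> s i) = s i ` {1..p}"
    using v openers_conj[OF v(2) _ \<open>0 < i\<close> asc] Cons.prems(2) by (simp add: S_inf_def)
  also have "\<dots> = {1..p}"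
    using \<open>i \<noteq> p\<close> \<open>0 < i\<close> by (intro transpose_image_eq) auto
  finally have "p \<notin> edge_labels es"
    using Cons.IH[OF es] by blast
  then show ?case
    using e(1) \<open>i \<noteq> p\<close> by (simp add: edge_labels_def)
qed

theorem theorem2p2:
  fixes z :: "int \<Rightarrow> int" and p q :: int
  assumes "z \<in> vex_involutions"
    and "p = (if z = id then 0 else int (card {i. 0 < i \<and> i < z i}))"
    and "q = (if z = id then 0 else Max {i. 0 < i \<and> z i \<noteq> i})"
  shows "(\<exists>es. pre_digraph.apath vex_graph z es (dom_perm p q) \<and> edge_labels es \<subseteq> {1..q - 1}) \<and>
    ((\<forall>i\<in>{1..p}. i < z i) \<longrightarrow>
      (\<forall>es. pre_digraph.apath vex_graph z es (dom_perm p q) \<and> edge_labels es \<subseteq> {1..q - 1}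
        \<longrightarrow> p \<notin> edge_labels es))"
proof -
  have S: "z \<in> S_inf" using assms(1) by (simp add: vex_involutions_def)
  have p: "p = int (card (openers z))"
    using assms(2) by (auto simp: openers_def)
  have "finite {i. z i \<noteq> i}" using S by (simp add: S_inf_def)
  then have fin: "finite {i. 0 < i \<and> z i \<noteq> i}" "finite (openers z)"
    by (auto simp: openers_def elim!: finite_subset[rotated])
  have q: "0 \<le> q \<and> (\<forall>j>q. z j = j)"
  proof (cases "z = id")
    case True
    then show ?thesis using assms(3) by simp
  next
    case False
    then obtain m where "z m \<noteq> m" by (auto simp: fun_eq_iff)
    \<comment> \<open>A moved point is positive, so the maximum is over a nonempty set and
      \<open>q\<close> is positive.\<close>
    then have "m \<in> {i. 0 < i \<and> z i \<noteq> i}"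
      using S by (auto simp: S_inf_def not_le[symmetric])
    then have "m \<le> q" using fin False assms(3) by (auto intro: Max_ge)
    moreover have "z j = j" if "q < j" "0 < j" for j
    proof (rule ccontr)
      assume "z j \<noteq> j"
      then have "j \<le> q" using Max_ge[OF fin(1), of j] that False assms(3) by simp
      then show False using that by simp
    qed
    ultimately show ?thesis
      using \<open>m \<in> _\<close> by force
  qed
  show ?thesis
  proof (intro conjI impI allI)
    show "\<exists>es. pre_digraph.apath vex_graph z es (dom_perm p q) \<and> edge_labels es \<subseteq> {1..q - 1}"
      using apath_to_dom_perm[OF assms(1)] q p by blast
  next
    fix es
    assume "\<forall>i\<in>{1..p}. i < z i"
      and es: "pre_digraph.apath vex_graph z es (dom_perm p q) \<and> edge_labels es \<subseteq> {1..q - 1}"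
    then have "{1..p} \<subseteq> openers z" by (auto simp: openers_def)
    \<comment> \<open>Both sets have \<open>p\<close> elements.\<close>
    then have "openers z = {1..p}"
      using card_subset_eq[OF fin(2), of "{1..p}"] p by simp
    then show "p \<notin> edge_labels es"
      using apath_avoids_label[of z es _ p] es p by auto
  qed
qed

end
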